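(* Let $n \ge 1$. Every joint profile for $n$ men and $n$ women is a mutually Latin profile.
   Context: A preference profile for $n$ men and $n$ women consists of a strict ranking (without ties) by each man of all $n$ women and by each woman of all $n$ men, with ranks $1,\dots,n$, where $1$ is the most preferred. For woman $w$ and man $m$, their mutual ranking is the pair $(s,t)$, where $s$ is the rank that $w$ gives to $m$ and $t$ is the rank that $m$ gives to $w$. A profile is called joint if there is a function $f:\{1,\dots,n\}\to\{1,\dots,n\}$ such that for every woman $w$ and every man $m$, if $w$ ranks $m$ as $i$, then $m$ ranks $w$ as $f(i)$. The function $f$ is called the key. The women's ranking matrix has as entry in row $w$, column $m$ the rank that woman $w$ gives to man $m$; the men's ranking matrix has as entry in row $m$, column $w$ the rank that man $m$ gives to woman $w$. A profile is called mutually Latin if both the women's ranking matrix and the men's ranking matrix are Latin squares. *)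

theory Defs
  imports Main "HOL-Library.FuncSet"
begin

text \<open>
  Men and women are both labelled by \<open>{1..n}\<close>. A profile is given by its two ranking
  matrices: \<open>W w m\<close> is the rank that woman \<open>w\<close> gives to man \<open>m\<close>, and \<open>M m w\<close> is the rank
  that man \<open>m\<close> gives to woman \<open>w\<close>. Values outside \<open>{1..n}\<close> are irrelevant.
  A strict ranking is a bijection from the ranked persons onto the ranks \<open>{1..n}\<close>.
\<close>

definition preference_profile ::
  "nat \<Rightarrow> (nat \<Rightarrow> nat \<Rightarrow> nat) \<Rightarrow> (nat \<Rightarrow> nat \<Rightarrow> nat) \<Rightarrow> bool" where
  "preference_profile n W M \<longleftrightarrow>
     (\<forall>w\<in>{1..n}. bij_betw (\<lambda>m. W w m) {1..n} {1..n}) \<and>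
     (\<forall>m\<in>{1..n}. bij_betw (\<lambda>w. M m w) {1..n} {1..n})"

definition joint ::
  "nat \<Rightarrow> (nat \<Rightarrow> nat \<Rightarrow> nat) \<Rightarrow> (nat \<Rightarrow> nat \<Rightarrow> nat) \<Rightarrow> bool" where
  "joint n W M \<longleftrightarrow>
     (\<exists>f \<in> {1..n} \<rightarrow> {1..n}. \<forall>w\<in>{1..n}. \<forall>m\<in>{1..n}. \<forall>i\<in>{1..n}.
        W w m = i \<longrightarrow> M m w = f i)"

definition latin_square :: "nat \<Rightarrow> (nat \<Rightarrow> nat \<Rightarrow> nat) \<Rightarrow> bool" where
  "latin_square n L \<longleftrightarrow>
     (\<forall>r\<in>{1..n}. \<forall>c\<in>{1..n}. L r c \<in> {1..n}) \<and>
     (\<forall>r\<in>{1..n}. \<forall>s\<in>{1..n}. \<exists>!c. c \<in> {1..n} \<and> L r c = s) \<and>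
     (\<forall>c\<in>{1..n}. \<forall>s\<in>{1..n}. \<exists>!r. r \<in> {1..n} \<and> L r c = s)"

definition mutually_latin ::
  "nat \<Rightarrow> (nat \<Rightarrow> nat \<Rightarrow> nat) \<Rightarrow> (nat \<Rightarrow> nat \<Rightarrow> nat) \<Rightarrow> bool" where
  "mutually_latin n W M \<longleftrightarrow> latin_square n W \<and> latin_square n M"

end

theory Submission
  imports Defs
begin

text \<open>
  Strictness of the rankings makes every row of either matrix a permutation of
  \<open>{1..n}\<close>, so only the columns are at stake. Jointness says \<open>M m w = f (W w m)\<close>: row \<open>m\<close>
  of \<open>M\<close> is column \<open>m\<close> of \<open>W\<close> followed by the key \<open>f\<close>. That row is a bijection, so its
  first factor, column \<open>m\<close> of \<open>W\<close>, is injective, and hence a permutation of the finite set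
  \<open>{1..n}\<close>. The key is then a quotient of two permutations, hence a permutation itself.
  Finally column \<open>w\<close> of \<open>M\<close> is row \<open>w\<close> of \<open>W\<close> followed by \<open>f\<close>, again a permutation.
\<close>

lemma bij_betw_ex1_preimage:
  assumes "bij_betw g A B" and "s \<in> B"
  shows "\<exists>!x. x \<in> A \<and> g x = s"
  using assms by (auto simp: bij_betw_def inj_on_def)

text \<open>Permutations compose and cancel, unlike the unique existence statements in the
  definition of a Latin square, so the argument is carried out on the former.\<close>

lemma latin_squareI:
  assumes rows: "\<And>r. r \<in> {1..n} \<Longrightarrow> bij_betw (\<lambda>c. L r c) {1..n} {1..n}"
    and columns: "\<And>c. c \<in> {1..n} \<Longrightarrow> bij_betw (\<lambda>r. L r c) {1..n} {1..n}"
  shows "latin_square n L"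
  unfolding latin_square_def
proof (intro conjI ballI)
  fix r c assume "r \<in> {1..n}" "c \<in> {1..n}"
  then show "L r c \<in> {1..n}" using bij_betwE[OF rows] by blast
next
  fix r s assume "r \<in> {1..n}" "s \<in> {1..n}"
  then show "\<exists>!c. c \<in> {1..n} \<and> L r c = s"
    using bij_betw_ex1_preimage[OF rows] by blast
next
  fix c s assume "c \<in> {1..n}" "s \<in> {1..n}"
  then show "\<exists>!r. r \<in> {1..n} \<and> L r c = s"
    using bij_betw_ex1_preimage[OF columns] by blast
qed

text \<open>Injectivity of a composite passes to the map applied first, and on a finite set an
  injective self-map is a permutation.\<close>

lemma bij_betw_first_factor:
  assumes "finite A" and "g ` A \<subseteq> A" and "bij_betw (f \<circ> g) A B"
  shows "bij_betw g A A"
proof -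
  have "inj_on g A"
    using assms(3) by (auto simp: bij_betw_def intro: inj_on_imageI2)
  then show ?thesis
    using assms(1,2) by (simp add: bij_betw_def endo_inj_surj)
qed

theorem theorem3:
  fixes n :: nat and W M :: "nat \<Rightarrow> nat \<Rightarrow> nat"
  assumes "n \<ge> 1"
    and "preference_profile n W M"
    and "joint n W M"
  shows "mutually_latin n W M"
proof -
  let ?N = "{1..n}"
  have W_rows: "bij_betw (\<lambda>m. W w m) ?N ?N" if "w \<in> ?N" for w
    using assms(2) that by (simp add: preference_profile_def)
  have M_rows: "bij_betw (\<lambda>w. M m w) ?N ?N" if "m \<in> ?N" for m
    using assms(2) that by (simp add: preference_profile_def)
  have W_range: "W w m \<in> ?N" if "w \<in> ?N" "m \<in> ?N" for w m
    using bij_betwE[OF W_rows] that by blast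
  obtain f where key: "\<And>w m. w \<in> ?N \<Longrightarrow> m \<in> ?N \<Longrightarrow> M m w = f (W w m)"
    using assms(3) W_range unfolding joint_def by metis

  have row_as_column: "bij_betw (f \<circ> (\<lambda>w. W w m)) ?N ?N" if "m \<in> ?N" for m
    using M_rows[OF that] bij_betw_cong[of ?N "\<lambda>w. M m w" "f \<circ> (\<lambda>w. W w m)"] key[OF _ that] by simp
  have W_columns: "bij_betw (\<lambda>w. W w m) ?N ?N" if "m \<in> ?N" for m
    using bij_betw_first_factor[OF _ _ row_as_column[OF that]] W_range that by blast

  \<comment> \<open>Some column is needed to cancel against, and \<open>n \<ge> 1\<close> provides the first one.\<close>
  have "1 \<in> ?N" using assms(1) by simp
  then have key_bij: "bij_betw f ?N ?N"
    using bij_betw_comp_iff[OF W_columns] row_as_column by blast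
  have M_columns: "bij_betw (\<lambda>m. M m w) ?N ?N" if "w \<in> ?N" for w
    using bij_betw_trans[OF W_rows[OF that] key_bij]
      bij_betw_cong[of ?N "\<lambda>m. M m w" "f \<circ> (\<lambda>m. W w m)"] key[OF that] by simp

  show ?thesis
    unfolding mutually_latin_def
    using latin_squareI[OF W_rows W_columns] latin_squareI[OF M_rows M_columns] by blast
qed

end
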